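(* The randomized online mechanism Algorithm 5 is (universally) truthful with respect to sensing costs: for every realization of its internal randomness, every arrival order, every user $A_i$ with true cost $\hat d_i$, and all fixed bids of the other users, the utility $p_i-\hat d_i|y_i|$ of $A_i$ is maximized by reporting $d_i=\hat d_i$ (his availability period being reported truthfully).
   Context: MCS setting. There are $m$ tasks; performing task $k$ has value $u_k>0$ per unit time. There are $n$ users $A_1,\dots,A_n$; user $A_i$ can perform exactly one, publicly known, task $\kappa_i$; put $\mu_i=u_{\kappa_i}$. The budget is $G>0$. User $A_i$ bids $b_i=(d_i,s_i,e_i)$ with declared cost per unit time $d_i>0$ and integers $s_i<e_i$; $T_i=[s_i,e_i]$. In the online setting users arrive one by one, in an order they cannot control, $n$ is known, and the schedule $y_i\subseteq T_i$ and payment $p_i$ of each user must be fixed irrevocably on arrival; a user may lie only about his true cost $\hat d_i$, while $T_i$ is his true availability. $|\cdot|$ is total length; a time unit is an interval $[t,t+1]$, $t\in\mathbb Z$. $R(\vec y)=\sum_{k=1}^m u_k\lfloor|\bigcup_{j:\kappa_j=k}y_j|\rfloor$. Order: $A_i\prec A_j$ iff $\mu_i/d_i<\mu_j/d_j$, or $\mu_i/d_i=\mu_j/d_j$ and $j>i$. Algorithm 1 (ApproxMCS) on a set $\mathcal A'$ of users with bids and budget $G$. Start with $\mathcal D=\mathcal A'$, all $y_i=\emptyset$. Repeat: let $A_j$ be the $\prec$-maximum of $\mathcal D$; $Z_j=T_j\setminus\bigcup_{i:\kappa_i=\kappa_j}y_i$; $q=\min\{|Z_j|,\lfloor\frac{G}{2d_j}-\frac{R(\vec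 y)}{\mu_j}\rfloor\}$; if $q>0$: set $y_j$ to the first (earliest) $q$ time units of $Z_j$, and remove from $\mathcal D$ all $A_i$ with $T_i\subseteq\bigcup_{\ell:\kappa_\ell=\kappa_i}y_\ell$; until $q<|Z_j|$ or $\mathcal D=\emptyset$. Return $\vec y$. Algorithm 4 (deterministic online mechanism). Initialize $\alpha=0$. Each of the first $\lfloor n/\mathbf e\rfloor$ arriving users $A_i$ gets $y_i=\emptyset$, $p_i=0$, and if $d_i\le G$ then $\alpha\leftarrow\max\{\alpha,\mu_i\}$. Among the later users, the first arriving $A_i$ with $\mu_i\ge\alpha$ and $d_i\le G$ gets as $y_i$ an arbitrary single time unit of $T_i$ and $p_i=G$; all others get $y_i=\emptyset$, $p_i=0$. ($\mathbf e$ is Euler's number.) Algorithm 5 (randomized online mechanism). With probability $1/2$ run Algorithm 4. Otherwise: draw $\xi$ from the binomial distribution $B(n,1/2)$, set $M=G$. Each of the first $\xi$ arriving users gets $y_i=\emptyset$, $p_i=0$; let $\vec r$ be the schedule returned by Algorithm 1 for these $\xi$ users with budget $G$. For each later arriving $A_i$: let $\eta=5G\mu_i/R(\vec r)$ and $F_i=T_i\setminus\bigcup_{\ell:\kappa_\ell=\kappa_i}y_\ell$; if $d_i\le\eta$, $\eta|F_i|\le M$ and $|F_i|\ge1$, set $y_i=F_i$, $p_i=\eta|F_i|$, $M\leftarrow M-p_i$; otherwise $y_i=\emptyset$, $p_i=0$. Convention: if $R(\vec r)=0$ (in particular if $\xi=0$), then $\eta=+\infty$ and no later user is scheduled. *)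

theory Defs
  imports "HOL-Probability.Probability" "HOL-Library.While_Combinator"
begin

text \<open>
  Tasks are \<open>1, ..., ntasks I\<close> and users are \<open>1, ..., nusers I\<close>; the only task that user \<open>i\<close> can
  perform is \<open>task I i\<close>.
\<close>

record mcs =
  ntasks :: nat
  val :: "nat \<Rightarrow> real"
  nusers :: nat
  task :: "nat \<Rightarrow> nat"
  budget :: real

record bid =
  cost :: real
  start :: int
  finish :: int

definition valid_mcs :: "mcs \<Rightarrow> bool" where
  "valid_mcs I \<longleftrightarrow>
     (\<forall>k\<in>{1..ntasks I}. val I k > 0) \<and>
     (\<forall>i\<in>{1..nusers I}. task I i \<in> {1..ntasks I}) \<and>
     budget I > 0"

definition valid_bid :: "bid \<Rightarrow> bool" where
  "valid_bid b \<longleftrightarrow> cost b > 0 \<and> start b < finish b"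

definition \<mu> :: "mcs \<Rightarrow> nat \<Rightarrow> real" where
  "\<mu> I i = val I (task I i)"

definition avail :: "bid \<Rightarrow> real set" where
  "avail b = {of_int (start b)..of_int (finish b)}"

definition time_unit :: "int \<Rightarrow> real set" where
  "time_unit t = {of_int t..of_int t + 1}"

definition len :: "real set \<Rightarrow> real" where
  "len X = measure lborel X"

type_synonym schedule = "nat \<Rightarrow> real set"
type_synonym outcome = "schedule \<times> (nat \<Rightarrow> real)"

definition covered :: "mcs \<Rightarrow> schedule \<Rightarrow> nat \<Rightarrow> real set" where
  "covered I y k = (\<Union>j\<in>{j\<in>{1..nusers I}. task I j = k}. y j)"

definition R :: "mcs \<Rightarrow> schedule \<Rightarrow> real" where
  "R I y = (\<Sum>k=1..ntasks I. val I k * of_int \<lfloor>len (covered I y k)\<rfloor>)"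

definition prec :: "mcs \<Rightarrow> (nat \<Rightarrow> bid) \<Rightarrow> nat \<Rightarrow> nat \<Rightarrow> bool" where
  "prec I B i j \<longleftrightarrow>
     \<mu> I i / cost (B i) < \<mu> I j / cost (B j) \<or>
     \<mu> I i / cost (B i) = \<mu> I j / cost (B j) \<and> j > i"

definition prec_max :: "mcs \<Rightarrow> (nat \<Rightarrow> bid) \<Rightarrow> nat set \<Rightarrow> nat" where
  "prec_max I B D = (THE j. j \<in> D \<and> (\<forall>i\<in>D - {j}. prec I B i j))"

text \<open>
  Removing closed intervals from an interval leaves half-open pieces, so a time unit counts as
  belonging to \<open>Z\<close> as soon as its interior does.
\<close>

definition units_of_set :: "real set \<Rightarrow> int set" where
  "units_of_set Z = {t. {of_int t<..<of_int t + 1} \<subseteq> Z}"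

definition first_units :: "nat \<Rightarrow> real set \<Rightarrow> real set" where
  "first_units q Z =
     (\<Union>t\<in>{t \<in> units_of_set Z. card {t' \<in> units_of_set Z. t' < t} < q}. time_unit t)"

text \<open>
  One pass through the body of the repeat-until loop of the offline approximation algorithm.  The
  state consists of the remaining users, the current schedule, and a flag recording whether the
  exit condition \<open>q < len Z\<close> was met.  For valid bids every pass that does not meet the exit condition
  removes the selected user, so the loop below terminates.  It is not entered for an empty set
  of users, for which the schedule is empty.
\<close>

definition approx_step ::
  "mcs \<Rightarrow> (nat \<Rightarrow> bid) \<Rightarrow> nat set \<times> schedule \<times> bool \<Rightarrow> nat set \<times> schedule \<times> bool" where
  "approx_step I B = (\<lambda>(D, y, _).
     let j = prec_max I B D;
         Z = avail (B j) - covered I y (task I j);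
         q = min (len Z) (of_int \<lfloor>budget I / (2 * cost (B j)) - R I y / \<mu> I j\<rfloor>)
     in if q > 0
        then let y' = y(j := first_units (nat \<lfloor>q\<rfloor>) Z)
             in ({i \<in> D. \<not> avail (B i) \<subseteq> covered I y' (task I i)}, y', q < len Z)
        else (D, y, q < len Z))"

definition approx_mcs :: "mcs \<Rightarrow> (nat \<Rightarrow> bid) \<Rightarrow> nat set \<Rightarrow> schedule" where
  "approx_mcs I B A =
     fst (snd (while (\<lambda>(D, _, stop). \<not> stop \<and> D \<noteq> {}) (approx_step I B)
       (A, \<lambda>_. {}, False)))"

definition no_outcome :: outcome where
  "no_outcome = (\<lambda>_. {}, \<lambda>_. 0)"

text \<open>
  The arrival order is a list \<open>arr\<close> enumerating the users.  The arbitrary choice of a time unit is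
  made by a rule \<open>pick\<close> that sees the users and bids that have arrived so far, the current user
  last.
\<close>

definition valid_arrival :: "mcs \<Rightarrow> nat list \<Rightarrow> bool" where
  "valid_arrival I arr \<longleftrightarrow> distinct arr \<and> set arr = {1..nusers I}"

type_synonym unit_rule = "(nat \<times> bid) list \<Rightarrow> int"

definition valid_rule :: "unit_rule \<Rightarrow> bool" where
  "valid_rule pick \<longleftrightarrow>
     (\<forall>h i b. valid_bid b \<longrightarrow> time_unit (pick (h @ [(i, b)])) \<subseteq> avail b)"

definition threshold :: "mcs \<Rightarrow> (nat \<Rightarrow> bid) \<Rightarrow> nat list \<Rightarrow> real" where
  "threshold I B xs =
     foldl (\<lambda>\<alpha> i. if cost (B i) \<le> budget I then max \<alpha> (\<mu> I i) else \<alpha>) 0 xs"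

definition secretary_mech ::
  "mcs \<Rightarrow> unit_rule \<Rightarrow> nat list \<Rightarrow> (nat \<Rightarrow> bid) \<Rightarrow> outcome" where
  "secretary_mech I pick arr B =
     (let k = nat \<lfloor>real (nusers I) / exp 1\<rfloor>;
          \<alpha> = threshold I B (take k arr)
      in case find (\<lambda>i. \<mu> I i \<ge> \<alpha> \<and> cost (B i) \<le> budget I) (drop k arr) of
           None \<Rightarrow> no_outcome
         | Some i \<Rightarrow>
             let h = map (\<lambda>j. (j, B j)) (takeWhile (\<lambda>j. j \<noteq> i) arr @ [i])
             in ((\<lambda>_. {})(i := time_unit (pick h)), (\<lambda>_. 0)(i := budget I)))"

text \<open>
  \<open>\<rho>\<close> is the value \<open>R\<close> of the sample schedule; the state consists of the schedule, the payments and
  the remaining budget.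
\<close>

definition offer_step ::
  "mcs \<Rightarrow> (nat \<Rightarrow> bid) \<Rightarrow> real \<Rightarrow> nat \<Rightarrow>
     schedule \<times> (nat \<Rightarrow> real) \<times> real \<Rightarrow> schedule \<times> (nat \<Rightarrow> real) \<times> real" where
  "offer_step I B \<rho> i = (\<lambda>(y, p, M).
     let \<eta> = 5 * budget I * \<mu> I i / \<rho>;
         F = avail (B i) - covered I y (task I i)
     in if cost (B i) \<le> \<eta> \<and> \<eta> * len F \<le> M \<and> len F \<ge> 1
        then (y(i := F), p(i := \<eta> * len F), M - \<eta> * len F)
        else (y, p, M))"

definition sampling_mech ::
  "mcs \<Rightarrow> nat \<Rightarrow> nat list \<Rightarrow> (nat \<Rightarrow> bid) \<Rightarrow> outcome" where
  "sampling_mech I \<xi> arr B =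
     (let \<rho> = R I (approx_mcs I B (set (take \<xi> arr)))
      in if \<rho> = 0 then no_outcome
         else let (y, p, M) =
                fold (offer_step I B \<rho>) (drop \<xi> arr) (\<lambda>_. {}, \<lambda>_. 0, budget I)
              in (y, p))"

text \<open>The internal randomness of the randomized mechanism.\<close>

datatype seed = Secretary | Sampling nat

definition seed_pmf :: "nat \<Rightarrow> seed pmf" where
  "seed_pmf n =
     bind_pmf (bernoulli_pmf (1/2))
       (\<lambda>c. if c then return_pmf Secretary else map_pmf Sampling (binomial_pmf n (1/2)))"

fun randomized_mech ::
  "mcs \<Rightarrow> unit_rule \<Rightarrow> seed \<Rightarrow> nat list \<Rightarrow> (nat \<Rightarrow> bid) \<Rightarrow> outcome" where
  "randomized_mech I pick Secretary arr B = secretary_mech I pick arr B"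
| "randomized_mech I pick (Sampling \<xi>) arr B = sampling_mech I \<xi> arr B"

definition utility :: "outcome \<Rightarrow> nat \<Rightarrow> real \<Rightarrow> real" where
  "utility out i c = snd out i - c * len (fst out i)"

end

theory Submission
  imports Defs
begin

text \<open>
  For each seed, the mechanism makes user \<open>i\<close> a take-it-or-leave-it offer: a price \<open>P\<close> per unit time
  and an amount \<open>L\<close> of time, both determined by the other bids and by the availability of \<open>i\<close>; the
  declared cost only decides whether the offer is accepted, which happens iff it is at most \<open>P\<close>.
  Accepting is worth \<open>(P - c) * L\<close> to a user with true cost \<open>c\<close>, so declaring \<open>c\<close> is optimal.
\<close>

definition posted_price :: "((nat \<Rightarrow> bid) \<Rightarrow> outcome) \<Rightarrow> (nat \<Rightarrow> bid) \<Rightarrow> nat \<Rightarrow> bool" where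
  "posted_price mech B i \<longleftrightarrow>
     (\<exists>P L. L \<ge> 0 \<and> (\<forall>d c. utility (mech (B(i := (B i)\<lparr>cost := d\<rparr>))) i c =
        (if d \<le> P then (P - c) * L else 0)))"

lemma posted_priceI:
  assumes "L \<ge> 0"
    and "\<And>d c. utility (mech (B(i := (B i)\<lparr>cost := d\<rparr>))) i c = (if d \<le> P then (P - c) * L else 0)"
  shows "posted_price mech B i"
  using assms unfolding posted_price_def by blast

text \<open>A false report changes the utility only by flipping acceptance: it either gives up
  \<open>(P - c) * L\<close> with \<open>c \<le> P\<close>, or takes it on with
  \<open>c > P\<close>, and \<open>L \<ge> 0\<close> fixes the sign.\<close>

lemma posted_price_truthful:
  assumes "posted_price mech B i"
  shows "utility (mech (B(i := (B i)\<lparr>cost := d\<rparr>))) i c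
       \<le> utility (mech (B(i := (B i)\<lparr>cost := c\<rparr>))) i c"
proof -
  obtain P L where "L \<ge> 0"
    and "\<And>d c. utility (mech (B(i := (B i)\<lparr>cost := d\<rparr>))) i c = (if d \<le> P then (P - c) * L else 0)"
    using assms unfolding posted_price_def by blast
  then show ?thesis
    by (auto simp: mult_nonpos_nonneg)
qed

lemma len_empty [simp]: "len {} = 0"
  by (simp add: len_def)

lemma len_time_unit [simp]: "len (time_unit t) = 1"
  by (simp add: len_def time_unit_def)

lemma utility_no_outcome [simp]: "utility no_outcome i c = 0"
  by (simp add: utility_def no_outcome_def)

lemma avail_cost_update [simp]: "avail (b\<lparr>cost := d\<rparr>) = avail b"
  by (simp add: avail_def)

section \<open>Observed users and the secretary mechanism\<close>

lemma distinct_take_drop: "distinct xs \<Longrightarrow> i \<in> set (drop k xs) \<Longrightarrow> i \<notin> set (take k xs)"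
  using set_take_disj_set_drop_if_distinct[of xs k k] by auto

text \<open>Every time unit has length one, so the choice made by \<open>pick\<close> drops out of
  the utility.\<close>

lemma utility_secretary_mech:
  "utility (secretary_mech I pick arr B) i c =
     (let k = nat \<lfloor>real (nusers I) / exp 1\<rfloor>;
          \<alpha> = threshold I B (take k arr)
      in if find (\<lambda>j. \<mu> I j \<ge> \<alpha> \<and> cost (B j) \<le> budget I) (drop k arr) = Some i
         then budget I - c else 0)"
  by (auto simp: secretary_mech_def utility_def no_outcome_def Let_def split: option.split)

lemma threshold_cong:
  assumes "\<And>j. j \<in> set xs \<Longrightarrow> B j = B' j"
  shows "threshold I B xs = threshold I B' xs"
  unfolding threshold_def using assms by (intro foldl_cong) auto

lemma find_append: "find P (xs @ ys) = (case find P xs of None \<Rightarrow> find P ys | Some x \<Rightarrow> Some x)"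
  by (induction xs) auto

text \<open>The price is the whole budget. The amount is one time unit if user \<open>i\<close>
  arrives after the observation phase, meets the threshold and comes before any other winner;
  otherwise it is zero.\<close>

lemma posted_price_secretary_mech:
  assumes "distinct arr"
  shows "posted_price (secretary_mech I pick arr) B i"
proof -
  define k where "k = nat \<lfloor>real (nusers I) / exp 1\<rfloor>"
  define \<alpha> where "\<alpha> = threshold I B (take k arr)"
  let ?B = "\<lambda>d. B(i := (B i)\<lparr>cost := d\<rparr>)"
  let ?Q = "\<lambda>B j. \<mu> I j \<ge> threshold I B (take k arr) \<and> cost (B j) \<le> budget I"
  show ?thesis
  proof (cases "i \<in> set (drop k arr)")
    case False
    then have "find (?Q (?B d)) (drop k arr) \<noteq> Some i" for d
      by (metis find_Some_iff nth_mem)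
    then show ?thesis
      by (intro posted_priceI[of 0 _ _ _ 0]) (auto simp: utility_secretary_mech k_def Let_def)
  next
    case True
    then obtain pre post where split: "drop k arr = pre @ i # post"
      by (meson split_list)
    have "distinct (drop k arr)"
      using assms by simp
    then have notin: "i \<notin> set pre" "i \<notin> set post"
      by (auto simp: split)
    have thr: "threshold I (?B d) (take k arr) = \<alpha>" for d
      unfolding \<alpha>_def using distinct_take_drop[OF assms True] by (intro threshold_cong) auto
    have pre: "find (?Q (?B d)) pre = find (\<lambda>j. \<mu> I j \<ge> \<alpha> \<and> cost (B j) \<le> budget I) pre" for d
      using notin by (intro find_cong) (auto simp: thr)
    \<comment> \<open>If \<open>i\<close> is rejected, the search goes on through
      \<open>post\<close>; it cannot return \<open>i\<close> there, as nobody arrives twice.\<close>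
    have post: "find (?Q (?B d)) post \<noteq> Some i" for d
      using notin by (metis find_Some_iff nth_mem)
    have sel: "find (?Q (?B d)) (drop k arr) = Some i \<longleftrightarrow>
        find (\<lambda>j. \<mu> I j \<ge> \<alpha> \<and> cost (B j) \<le> budget I) pre = None \<and> \<mu> I i \<ge> \<alpha> \<and> d \<le> budget I"
      for d
    proof (cases "find (\<lambda>j. \<mu> I j \<ge> \<alpha> \<and> cost (B j) \<le> budget I) pre")
      case None
      then show ?thesis
        using pre[of d] post[of d] by (auto simp: split find_append thr)
    next
      case (Some j)
      then have "j \<noteq> i"
        using notin by (metis find_Some_iff nth_mem)
      with Some show ?thesis
        using pre[of d] by (auto simp: split find_append)
    qed
    show ?thesis
      by (rule posted_priceI[where P = "budget I"
            and L = "if find (\<lambda>j. \<mu> I j \<ge> \<alpha> \<and> cost (B j) \<le> budget I) pre = None \<and> \<mu> I i \<ge> \<alpha>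
                     then 1 else 0"])
        (use sel in \<open>auto simp: utility_secretary_mech k_def Let_def\<close>)
  qed
qed

section \<open>The offline schedule depends only on the bids of its users\<close>

lemma prec_max_cong:
  assumes "\<And>j. j \<in> D \<Longrightarrow> B j = B' j"
  shows "prec_max I B D = prec_max I B' D"
  unfolding prec_max_def prec_def by (rule arg_cong[where f = The]) (use assms in fastforce)

text \<open>Since \<open>prec_max\<close> is a definite description, membership requires a unique
  maximum. Ties are broken by index, so \<open>prec\<close> is a strict total order, and a finite
  nonempty set has exactly one maximum.\<close>

lemma prec_max_in:
  assumes "finite D" "D \<noteq> {}"
  shows "prec_max I B D \<in> D"
proof -
  have "\<exists>j. j \<in> D \<and> (\<forall>i\<in>D - {j}. prec I B i j)"
    using assms
  proof (induction rule: finite_ne_induct)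
    case (insert x D)
    then obtain j where j: "j \<in> D" "\<forall>i\<in>D - {j}. prec I B i j"
      by blast
    have "x \<noteq> j"
      using insert j by blast
    then consider "prec I B x j" | "prec I B j x"
      unfolding prec_def by linarith
    then show ?case
    proof cases
      case 1
      with j show ?thesis by blast
    next
      case 2
      have "prec I B i x" if "i \<in> D" for i
      proof (cases "i = j")
        case False
        with j that have "prec I B i j"
          by blast
        with 2 show ?thesis
          unfolding prec_def by linarith
      qed (use 2 in simp)
      then show ?thesis by blast
    qed
  qed auto
  moreover have "j = j'"
    if "j \<in> D \<and> (\<forall>i\<in>D - {j}. prec I B i j)" "j' \<in> D \<and> (\<forall>i\<in>D - {j'}. prec I B i j')" for j j'
  proof (rule ccontr)
    assume "j \<noteq> j'"
    with that have "prec I B j j'" "prec I B j' j"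
      by auto
    then show False
      unfolding prec_def by linarith
  qed
  ultimately have "\<exists>!j. j \<in> D \<and> (\<forall>i\<in>D - {j}. prec I B i j)"
    by blast
  from theI'[OF this] show ?thesis
    unfolding prec_max_def by blast
qed

text \<open>Each pass reads only bids of remaining users, and these always lie in \<open>A\<close>,
  so the loops for \<open>B\<close> and \<open>B'\<close> run in lockstep.\<close>

lemma approx_mcs_cong:
  assumes "finite A" and eq: "\<And>j. j \<in> A \<Longrightarrow> B j = B' j"
  shows "approx_mcs I B A = approx_mcs I B' A"
proof -
  let ?b = "\<lambda>(D, _, stop). \<not> stop \<and> D \<noteq> {}"
  have step: "approx_step I B (D, y, s) = approx_step I B' (D, y, s)"
    and sub: "fst (approx_step I B (D, y, s)) \<subseteq> A"
    if "D \<subseteq> A" "D \<noteq> {}" for D y s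
  proof -
    have D: "B j = B' j" if "j \<in> D" for j
      using \<open>D \<subseteq> A\<close> eq that by blast
    have "finite D"
      using \<open>D \<subseteq> A\<close> assms(1) by (rule finite_subset)
    then have "B (prec_max I B D) = B' (prec_max I B D)"
      using D prec_max_in \<open>D \<noteq> {}\<close> by blast
    moreover have "prec_max I B D = prec_max I B' D"
      using D by (rule prec_max_cong)
    moreover have "{i \<in> D. \<not> avail (B i) \<subseteq> X i} = {i \<in> D. \<not> avail (B' i) \<subseteq> X i}" for X
      using D by auto
    ultimately show "approx_step I B (D, y, s) = approx_step I B' (D, y, s)"
      by (simp add: approx_step_def Let_def)
    show "fst (approx_step I B (D, y, s)) \<subseteq> A"
      using \<open>D \<subseteq> A\<close> by (auto simp: approx_step_def Let_def split: if_splits)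
  qed
  \<comment> \<open>Commutation with \<open>id\<close> turns stepwise agreement under the invariant
    into equality of the loops; at the level of \<open>while_option\<close> this covers terminating
    and diverging runs alike.\<close>
  have "map_option id (while_option ?b (approx_step I B) (A, \<lambda>_. {}, False)) =
      while_option ?b (approx_step I B') (id (A, \<lambda>_. {}, False))"
  proof (rule while_option_commute_invariant[where P = "\<lambda>x. fst x \<subseteq> A"])
    fix x :: "nat set \<times> schedule \<times> bool"
    assume x: "fst x \<subseteq> A" "?b x"
    obtain D y s where "x = (D, y, s)"
      by (cases x)
    with x sub[of D y s] step[of D y s]
    show "fst (approx_step I B x) \<subseteq> A" "id (approx_step I B x) = approx_step I B' (id x)"
      by auto
  qed auto
  then show ?thesis
    by (simp add: approx_mcs_def while_def option.map_id)
qed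

section \<open>The sampling mechanism\<close>

lemma offer_step_cong:
  "B i = B' i \<Longrightarrow> offer_step I B \<rho> i = offer_step I B' \<rho> i"
  by (simp add: offer_step_def)

text \<open>A step writes only the entries of the user it serves, so those of \<open>i\<close> can
  change only at the turn of \<open>i\<close>.\<close>

lemma fold_offer_step_other:
  assumes "i \<notin> set xs"
  shows "fst (fold (offer_step I B \<rho>) xs s) i = fst s i"
    and "fst (snd (fold (offer_step I B \<rho>) xs s)) i = fst (snd s) i"
  using assms by (induction xs arbitrary: s) (auto simp: offer_step_def Let_def split: prod.splits)

lemma utility_sampling_mech:
  "utility (sampling_mech I \<xi> arr B) i c =
     (let \<rho> = R I (approx_mcs I B (set (take \<xi> arr)));
          s = fold (offer_step I B \<rho>) (drop \<xi> arr) (\<lambda>_. {}, \<lambda>_. 0, budget I)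
      in if \<rho> = 0 then 0 else fst (snd s) i - c * len (fst s i))"
  by (auto simp: sampling_mech_def utility_def no_outcome_def Let_def split: prod.split)

text \<open>For a user outside the sample, \<open>\<rho>\<close> and the state met on arrival come
  from other bids. Later users may react to the report of \<open>i\<close>, but cannot alter the
  entries of \<open>i\<close>.\<close>

lemma posted_price_sampling_mech:
  assumes "distinct arr"
  shows "posted_price (sampling_mech I \<xi> arr) B i"
proof (cases "i \<in> set (drop \<xi> arr)")
  case False
  then show ?thesis
    by (intro posted_priceI[of 0 _ _ _ 0])
      (auto simp: utility_sampling_mech Let_def fold_offer_step_other)
next
  case True
  let ?B = "\<lambda>d. B(i := (B i)\<lparr>cost := d\<rparr>)"
  define \<rho> where "\<rho> = R I (approx_mcs I B (set (take \<xi> arr)))"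
  have \<rho>: "R I (approx_mcs I (?B d) (set (take \<xi> arr))) = \<rho>" for d
  proof -
    have "approx_mcs I (?B d) (set (take \<xi> arr)) = approx_mcs I B (set (take \<xi> arr))"
      using distinct_take_drop[OF assms True] by (intro approx_mcs_cong) auto
    then show ?thesis
      by (simp add: \<rho>_def)
  qed
  obtain pre post where split: "drop \<xi> arr = pre @ i # post"
    using True by (meson split_list)
  have "distinct (drop \<xi> arr)"
    using assms by simp
  then have notin: "i \<notin> set pre" "i \<notin> set post"
    by (auto simp: split)
  obtain y p M where s: "fold (offer_step I B \<rho>) pre (\<lambda>_. {}, \<lambda>_. 0, budget I) = (y, p, M)"
    by (metis prod_cases3)
  have pre: "fold (offer_step I (?B d) \<rho>) pre (\<lambda>_. {}, \<lambda>_. 0, budget I) = (y, p, M)" for d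
    unfolding s[symmetric] using notin
    by (intro fold_cong refl offer_step_cong) auto
  \<comment> \<open>These initial values make a refused offer worth exactly zero.\<close>
  have i0: "y i = {}" "p i = 0"
    using fold_offer_step_other[OF notin(1), of I B \<rho> "(\<lambda>_. {}, \<lambda>_. 0, budget I)"]
    by (simp_all add: s)
  define \<eta> where "\<eta> = 5 * budget I * \<mu> I i / \<rho>"
  define F where "F = avail (B i) - covered I y (task I i)"
  have util: "utility (sampling_mech I \<xi> arr (?B d)) i c =
      (if \<rho> \<noteq> 0 \<and> d \<le> \<eta> \<and> \<eta> * len F \<le> M \<and> len F \<ge> 1 then (\<eta> - c) * len F else 0)" for d c
    using notin i0
    by (simp add: utility_sampling_mech Let_def \<rho> split pre fold_offer_step_other)
      (simp add: offer_step_def Let_def left_diff_distrib flip: \<eta>_def F_def)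
  show ?thesis
    \<comment> \<open>All conditions other than \<open>d \<le> \<eta>\<close> are independent of the
      report and go into the amount; this includes \<open>\<rho> \<noteq> 0\<close>, without which
      nobody is scheduled.\<close>
    by (rule posted_priceI[where P = \<eta>
          and L = "if \<rho> \<noteq> 0 \<and> \<eta> * len F \<le> M \<and> len F \<ge> 1 then len F else 0"])
      (auto simp: util)
qed

theorem theorem11:
  fixes I :: mcs and pick :: unit_rule and \<omega> :: seed and arr :: "nat list"
    and B :: "nat \<Rightarrow> bid" and i :: nat and true_cost d :: real
  assumes "valid_mcs I"
    and "valid_rule pick"
    and "\<omega> \<in> set_pmf (seed_pmf (nusers I))"
    and "valid_arrival I arr"
    and "\<forall>j\<in>{1..nusers I}. valid_bid (B j)"
    and "i \<in> {1..nusers I}"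
    and "true_cost > 0"
    and "d > 0"
  shows "utility (randomized_mech I pick \<omega> arr (B(i := (B i)\<lparr>cost := d\<rparr>))) i true_cost
       \<le> utility (randomized_mech I pick \<omega> arr (B(i := (B i)\<lparr>cost := true_cost\<rparr>))) i true_cost"
proof -
  have "distinct arr"
    using assms(4) by (simp add: valid_arrival_def)
  then have "posted_price (randomized_mech I pick \<omega> arr) B i"
  proof (cases \<omega>)
    case Secretary
    \<comment> \<open>\<open>posted_price\<close> takes the mechanism as a function of the bids, so
      the defining equation is needed without its last argument.\<close>
    have "randomized_mech I pick Secretary arr = secretary_mech I pick arr"
      by (intro ext) simp
    then show ?thesis
      by (simp add: Secretary posted_price_secretary_mech \<open>distinct arr\<close>)
  next
    case (Sampling \<xi>)
    have "randomized_mech I pick (Sampling \<xi>) arr = sampling_mech I \<xi> arr"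
      by (intro ext) simp
    then show ?thesis
      by (simp add: Sampling posted_price_sampling_mech \<open>distinct arr\<close>)
  qed
  then show ?thesis
    by (rule posted_price_truthful)
qed

end
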